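(* Let $\phi=(1+\sqrt5)/2$, and let $F_n$, $L_n$ be the Fibonacci and Lucas numbers. For every non-negative integer $k$, \[ 2\tan^{-1}\left(\frac{1}{\phi^{2k}}\right)=\tan^{-1}\left(\frac{\sqrt 5}{L_{2k+1}}\right)+\tan^{-1}\left(\frac{1}{F_{2k+1}\sqrt 5}\right) \] and \[ 2\tan^{-1}\left(\frac{1}{\phi^{2k+2}}\right)=\tan^{-1}\left(\frac{\sqrt 5}{L_{2k+1}}\right)-\tan^{-1}\left(\frac{1}{F_{2k+1}\sqrt 5}\right). \]
   Context: $\phi=(1+\sqrt5)/2$ is the golden ratio. The Fibonacci numbers are defined by $F_0=0$, $F_1=1$, $F_n=F_{n-1}+F_{n-2}$. The Lucas numbers are $L_n=F_{n-1}+F_{n+1}$. $\tan^{-1}$ denotes the principal branch of the arctangent, with values in $(-\pi/2,\pi/2)$. *)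

theory Defs
  imports Complex_Main "HOL-Number_Theory.Fib"
begin

definition golden_ratio :: real
  where "golden_ratio = (1 + sqrt 5) / 2"

text \<open>
  Lucas numbers \<open>L\<^sub>n = F\<^sub>n\<^sub>-\<^sub>1 + F\<^sub>n\<^sub>+\<^sub>1\<close>. Subtraction on \<^typ>\<open>nat\<close> truncates, so \<open>n = 0\<close> is a
  separate equation: running the Fibonacci recurrence backwards gives \<open>F\<^sub>-\<^sub>1 = 1\<close>, hence
  \<open>L\<^sub>0 = 1 + 1 = 2\<close>.
\<close>
fun lucas :: "nat \<Rightarrow> nat"
  where
    "lucas 0 = 2"
  | "lucas (Suc n) = fib n + fib (n + 2)"

end

theory Submission
  imports Defs
begin

text \<open>
  Put \<open>P = \<phi>\<^sup>2\<^sup>k\<^sup>+\<^sup>1\<close>, \<open>x = \<phi> / P\<close> and \<open>y = 1 / (\<phi> P)\<close>. Since the exponent is odd, Binet's formulas read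
  \<open>L\<^sub>2\<^sub>k\<^sub>+\<^sub>1 = P - 1 / P\<close> and \<open>\<surd>5 F\<^sub>2\<^sub>k\<^sub>+\<^sub>1 = P + 1 / P\<close>, while \<open>\<phi> + 1 / \<phi> = \<surd>5\<close> and \<open>\<phi> - 1 / \<phi> = 1\<close>.
  So the addition theorem turns \<open>arctan x + arctan y\<close> and \<open>arctan x - arctan y\<close> into the two
  arctangents on the right-hand sides; the claims are the sum and the difference of these equations.
\<close>

lemma golden_ratio_gt_1: "golden_ratio > 1"
  unfolding golden_ratio_def using real_less_rsqrt[of 1 5] by simp

text \<open>\<open>golden_ratio\<close> and \<open>(1 - sqrt 5) / 2\<close> are the roots of
  \<open>t^2 = t + 1\<close>, so their product is -1.\<close>

lemma golden_ratio_conjugate: "- 1 / golden_ratio = (1 - sqrt 5) / 2"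
proof -
  have "golden_ratio * ((1 - sqrt 5) / 2) = - 1"
    by (simp add: golden_ratio_def field_simps)
  then show ?thesis
    using golden_ratio_gt_1 by (subst nonzero_divide_eq_eq) (simp_all add: mult.commute)
qed

lemma fib_binet:
  "sqrt 5 * real (fib n) = golden_ratio ^ n - (- 1 / golden_ratio) ^ n"
  unfolding golden_ratio_conjugate by (simp add: fib_closed_form golden_ratio_def)

lemma lucas_binet:
  "real (lucas n) = golden_ratio ^ n + (- 1 / golden_ratio) ^ n"
proof (cases n)
  case (Suc m)
  define s where "s = - 1 / golden_ratio"
  have gs: "golden_ratio * s = - 1" "golden_ratio - s = sqrt 5"
    using golden_ratio_gt_1 unfolding s_def
    by (simp, unfold golden_ratio_conjugate, simp add: golden_ratio_def field_simps)
  have "sqrt 5 * real (lucas n) =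
      golden_ratio ^ m - s ^ m + (golden_ratio ^ (m + 2) - s ^ (m + 2))"
    by (simp only: Suc lucas.simps of_nat_add distrib_left fib_binet s_def)
  \<comment> \<open>The factor \<open>- golden_ratio * s = 1\<close> raises the degree of the first
    difference to \<open>m + 2\<close>, so that \<open>golden_ratio - s\<close> can be split off and
    cancelled against \<open>sqrt 5\<close>.\<close>
  also have "\<dots> = golden_ratio ^ (m + 2) - s ^ (m + 2) - golden_ratio * s * (golden_ratio ^ m - s ^ m)"
    by (simp add: gs(1))
  also have "\<dots> = (golden_ratio - s) * (golden_ratio ^ n + s ^ n)"
    by (simp add: Suc algebra_simps)
  finally show ?thesis
    unfolding gs(2) by (simp add: s_def)
qed simp

theorem theorem5:
  fixes k :: nat
  shows "2 * arctan (1 / golden_ratio ^ (2 * k)) =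
           arctan (sqrt 5 / real (lucas (2 * k + 1))) + arctan (1 / (real (fib (2 * k + 1)) * sqrt 5))
       \<and> 2 * arctan (1 / golden_ratio ^ (2 * k + 2)) =
           arctan (sqrt 5 / real (lucas (2 * k + 1))) - arctan (1 / (real (fib (2 * k + 1)) * sqrt 5))"
proof -
  define g where "g = golden_ratio"
  define P where "P = g ^ (2 * k + 1)"
  define x where "x = 1 / g ^ (2 * k)"
  define y where "y = 1 / g ^ (2 * k + 2)"
  have g: "g > 1"
    by (simp add: g_def golden_ratio_gt_1)
  have P: "P > 1"
    unfolding P_def using g by (intro one_less_power) auto
  have "1 / g = (sqrt 5 - 1) / 2"
    using golden_ratio_conjugate by (simp add: g_def)
  then have "g + 1 / g = sqrt 5" and "g - 1 / g = 1"
    unfolding g_def golden_ratio_def by argo+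
  moreover have xP: "x = g / P" and yP: "y = (1 / g) / P"
    using g by (simp_all add: x_def y_def P_def)
  ultimately have sum: "x + y = sqrt 5 / P" and diff: "x - y = 1 / P"
    by (simp_all only: flip: add_divide_distrib diff_divide_distrib)
  have xy: "x * y = 1 / P\<^sup>2"
    using g by (simp add: xP yP power2_eq_square)
  \<comment> \<open>For \<open>k = 0\<close> this is an equality; \<open>arctan_add\<close> needs a
    strict bound only on its second argument.\<close>
  have x: "\<bar>x\<bar> \<le> 1"
    using g by (simp add: x_def)
  have "1 < g ^ (2 * k + 2)"
    using g by (intro one_less_power) auto
  then have y: "\<bar>y\<bar> < 1"
    by (simp add: y_def)
  have odd: "(- 1 / g) ^ (2 * k + 1) = - (1 / P)"
    by (simp add: P_def power_divide)
  have L: "real (lucas (2 * k + 1)) = P - 1 / P"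
    using lucas_binet[of "2 * k + 1"] odd by (simp only: P_def flip: g_def)
  have F: "real (fib (2 * k + 1)) * sqrt 5 = P + 1 / P"
    using fib_binet[of "2 * k + 1"] odd by (simp only: P_def mult.commute flip: g_def)
  \<comment> \<open>Expand the fraction by \<open>P\<close>.\<close>
  have "(x + y) / (1 - x * y) = sqrt 5 / (P - 1 / P)"
    unfolding sum xy using P by (simp add: field_simps power2_eq_square)
  then have plus: "arctan x + arctan y = arctan (sqrt 5 / real (lucas (2 * k + 1)))"
    using arctan_add[OF x y] by (simp only: L)
  have "(x - y) / (1 + x * y) = 1 / (P + 1 / P)"
    unfolding diff xy using P by (simp add: field_simps power2_eq_square)
  then have minus: "arctan x - arctan y = arctan (1 / (real (fib (2 * k + 1)) * sqrt 5))"
    using arctan_add[OF x, of "- y"] y unfolding F by (simp add: arctan_minus)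
  show ?thesis
    unfolding g_def[symmetric] x_def[symmetric] y_def[symmetric] plus[symmetric] minus[symmetric]
    by simp
qed

end
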